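(* Let $\mathbb{K}$ be a field and let $T$ be any $n\times n$ matrix over $\mathbb{K}$, regarded as the system map of a linear dynamical system with parallel update whose $i$-th local function is given by the $i$-th row of $T$. Then, after a suitable reordering of the local functions (i.e. of the rows of $T$), the system is equal to a linear SDS: there exist an $n\times n$ permutation matrix $P$, a connected simple graph $G$ on vertices $v_1,\dots,v_n$, a matrix $A'$ of local functions compatible with $G$, and a permutation update schedule $\pi$ such that the system map $(G,A',\pi)$ equals $PT$.
   Context: A linear SDS $(G,A,\pi)$ over a field $\mathbb{K}$: $G$ is a connected simple graph with vertices $v_1,\dots,v_n$; $A=(a_{ij})$ is an $n\times n$ matrix over $\mathbb{K}$ ("compatible with $G$") with $a_{ij}=0$ whenever $i\neq j$ and $v_i,v_j$ are not adjacent; the local function of $v_i$ is $x_i\mapsto a_{i1}x_1+\cdots+a_{in}x_n$, inducing the matrix $F_{v_i}$ equal to the identity except that its $i$-th row is $(a_{i1},\dots,a_{in})$. For a permutation $\pi=\pi_1\cdots\pi_n$ of the vertices, the system map is $(G,A,\pi)=F_{\pi_n}\cdots F_{\pi_1}$. *)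

theory Defs
  imports
    "Jordan_Normal_Form.Matrix"
    "Graph_Theory.Pair_Digraph"
    "Graph_Theory.Digraph_Component"
    "HOL-Combinatorics.Multiset_Permutations"
begin

text \<open>
  The vertices \<open>v\<^sub>1, \<dots>, v\<^sub>n\<close> are the natural numbers \<open>0, \<dots>, n - 1\<close>, matching the indexing
  of matrix rows and columns. A simple graph is a symmetric, loop-free, finite set of arcs
  (locale \<open>pair_graph\<close>).
\<close>

definition compatible_mat :: "nat \<Rightarrow> nat pair_pre_digraph \<Rightarrow> 'a::zero mat \<Rightarrow> bool" where
  "compatible_mat n G A \<longleftrightarrow>
     A \<in> carrier_mat n n \<and>
     (\<forall>i<n. \<forall>j<n. i \<noteq> j \<and> (i, j) \<notin> parcs G \<longrightarrow> A $$ (i, j) = 0)"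

definition linear_sds ::
  "nat \<Rightarrow> nat pair_pre_digraph \<Rightarrow> 'a::field mat \<Rightarrow> nat list \<Rightarrow> bool" where
  "linear_sds n G A \<pi> \<longleftrightarrow>
     pair_graph G \<and> pverts G = {0..<n} \<and> Digraph_Component.connected (with_proj G) \<and>
     compatible_mat n G A \<and> \<pi> \<in> permutations_of_set {0..<n}"

definition local_mat :: "nat \<Rightarrow> 'a::field mat \<Rightarrow> nat \<Rightarrow> 'a mat" where
  "local_mat n A i =
     mat n n (\<lambda>(r, c). if r = i then A $$ (i, c) else if r = c then 1 else 0)"

text \<open>
  The first vertex of the schedule is the rightmost factor:
  \<open>sds_map n A [p\<^sub>1, \<dots>, p\<^sub>k] = local_mat n A p\<^sub>k * \<dots> * local_mat n A p\<^sub>1\<close>.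
  The graph constrains \<open>A\<close> only through \<open>linear_sds\<close> and does not enter the product.
\<close>

definition sds_map :: "nat \<Rightarrow> 'a::field mat \<Rightarrow> nat list \<Rightarrow> 'a mat" where
  "sds_map n A \<pi> = fold (\<lambda>i M. local_mat n A i * M) \<pi> (1\<^sub>m n)"

text \<open>Row \<open>i\<close> of \<open>P * T\<close> is row \<open>\<sigma> i\<close> of \<open>T\<close>.\<close>

definition permutation_mat :: "nat \<Rightarrow> 'a::field mat \<Rightarrow> bool" where
  "permutation_mat n P \<longleftrightarrow>
     (\<exists>\<sigma>. \<sigma> permutes {0..<n} \<and> P = mat n n (\<lambda>(i, j). if j = \<sigma> i then 1 else 0))"

lemma local_mat_mult_vec:
  assumes "A \<in> carrier_mat n n" and "x \<in> carrier_vec n"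
  shows "local_mat n A i *\<^sub>v x = vec n (\<lambda>r. if r = i then row A i \<bullet> x else x $ r)"
proof (intro eq_vecI)
  fix r assume "r < dim_vec (vec n (\<lambda>r. if r = i then row A i \<bullet> x else x $ r))"
  then have r: "r < n" by simp
  show "(local_mat n A i *\<^sub>v x) $ r = vec n (\<lambda>r. if r = i then row A i \<bullet> x else x $ r) $ r"
  proof (cases "r = i")
    case True
    then show ?thesis
      using r assms by (auto simp: local_mat_def scalar_prod_def intro!: sum.cong)
  next
    case False
    then have "row (local_mat n A i) r = unit_vec n r"
      using r by (intro eq_vecI) (auto simp: local_mat_def unit_vec_def)
    moreover have "dim_row (local_mat n A i) = n"
      by (simp add: local_mat_def)
    ultimately show ?thesis
      using r False assms by simp
  qed
qed (simp add: local_mat_def)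

end

theory Submission
  imports Defs
begin

text \<open>
  Updating the vertices in the order \<open>0, \<dots>, n - 1\<close> computes \<open>y\<^sub>i = (\<Sum>j<i. a\<^sub>i\<^sub>j y\<^sub>j) + (\<Sum>j\<ge>i. a\<^sub>i\<^sub>j x\<^sub>j)\<close>,
  so on the complete graph a matrix \<open>B\<close> is a system map as soon as, for every \<open>i\<close>, row \<open>i\<close> of \<open>B\<close>
  agrees in the columns below \<open>i\<close> with a linear combination of the earlier rows. Gaussian elimination
  with row pivoting orders the rows of any square matrix in this way, singular or not.
\<close>

lemma pivot_ordering:
  fixes w :: "'b \<Rightarrow> nat \<Rightarrow> 'a::field"
  assumes "finite S" and "\<And>r c. r \<in> S \<Longrightarrow> c < m \<Longrightarrow> w r c = 0"
  shows "\<exists>xs. distinct xs \<and> set xs = S \<and>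
    (\<forall>i<length xs. \<exists>a. \<forall>c<m + i. w (xs ! i) c = (\<Sum>j<i. a j * w (xs ! j) c))"
  using assms
\<comment> \<open>\<open>S\<close> holds the rows not yet placed, \<open>w\<close> their partly
  reduced values, and \<open>m\<close> counts the columns already cleared. Each step places one row
  and clears one column, so position \<open>i\<close> in the list controls the columns
  \<open>c < m + i\<close>.\<close>
proof (induction "card S" arbitrary: S m w)
  case 0
  then show ?case by (intro exI[of _ "[]"]) auto
next
  case (Suc k)
  then have "S \<noteq> {}" by auto
  \<comment> \<open>Any row with a nonzero entry in column \<open>m\<close> serves as pivot; if
    there is none, any row of \<open>S\<close> does, because the column is already clear.\<close>
  then obtain p where p: "p \<in> S" and pivot: "w p m = 0 \<Longrightarrow> \<forall>r\<in>S. w r m = 0"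
    by (metis ex_in_conv)
  \<comment> \<open>Without a nonzero pivot, division by zero yields \<open>\<alpha> r = 0\<close>,
    so \<open>w'\<close> is just \<open>w\<close> and both cases share one definition.\<close>
  define \<alpha> where "\<alpha> r = w r m / w p m" for r
  define w' where "w' r c = w r c - \<alpha> r * w p c" for r c
  have "w' r c = 0" if "r \<in> S - {p}" "c < Suc m" for r c
    using that p pivot Suc.prems(2) by (cases "c = m"; cases "w p m = 0") (auto simp: w'_def \<alpha>_def)
  moreover have "k = card (S - {p})" "finite (S - {p})"
    using Suc.hyps(2) Suc.prems(1) p by auto
  ultimately obtain xs where xs: "distinct xs" "set xs = S - {p}"
    and comb: "\<forall>i<length xs. \<exists>a. \<forall>c<Suc m + i. w' (xs ! i) c = (\<Sum>j<i. a j * w' (xs ! j) c)"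
    using Suc.hyps(1)[of "S - {p}" "Suc m" w'] by blast
  have "\<exists>a. \<forall>c<m + i. w ((p # xs) ! i) c = (\<Sum>j<i. a j * w ((p # xs) ! j) c)"
    if i: "i < length (p # xs)" for i
  proof (cases i)
    case 0
    then show ?thesis using Suc.prems(2) p by auto
  next
    case i': (Suc i')
    then obtain b where b: "\<And>c. c < Suc m + i' \<Longrightarrow> w' (xs ! i') c = (\<Sum>j<i'. b j * w' (xs ! j) c)"
      using comb i by auto
    \<comment> \<open>Substituting \<open>w' r = w r - \<alpha> r * w p\<close> into the combination
      for the reduced rows keeps each \<open>b l\<close> as the coefficient of
      \<open>xs ! l\<close>; the multiples of the pivot row collect at index 0.\<close>
    define a where "a j = (case j of 0 \<Rightarrow> \<alpha> (xs ! i') - (\<Sum>l<i'. b l * \<alpha> (xs ! l)) | Suc l \<Rightarrow> b l)" for j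
    have "w (xs ! i') c = (\<Sum>j<Suc i'. a j * w ((p # xs) ! j) c)" if "c < m + i" for c
    proof -
      have "w (xs ! i') c = \<alpha> (xs ! i') * w p c + (\<Sum>j<i'. b j * w' (xs ! j) c)"
        using b[of c] that i' by (simp add: w'_def algebra_simps)
      also have "\<dots> = (\<Sum>j<Suc i'. a j * w ((p # xs) ! j) c)"
        unfolding sum.lessThan_Suc_shift
        by (simp add: a_def w'_def algebra_simps sum_subtractf sum_distrib_left)
      finally show ?thesis .
    qed
    then show ?thesis using i' by auto
  qed
  moreover have "distinct (p # xs)" "set (p # xs) = S" using xs p by auto
  ultimately show ?case by blast
qed

text \<open>When vertex \<open>k\<close> is updated, the rows above \<open>k\<close> already equal
  those of \<open>B\<close> and the rows from \<open>k\<close> on are still unit vectors. Entries of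
  \<open>A\<close> from the diagonal rightwards therefore correct their column freely, while to the
  left of it only combinations of earlier rows of \<open>B\<close> are available, which is what
  \<open>comb\<close> provides.\<close>

lemma sds_map_upt:
  fixes B :: "'a::field mat"
  assumes B: "B \<in> carrier_mat n n"
    and comb: "\<And>i c. i < n \<Longrightarrow> c < i \<Longrightarrow> B $$ (i, c) = (\<Sum>j<i. a i j * B $$ (j, c))"
    and A: "A = mat n n (\<lambda>(i, c). if c < i then a i c
                   else B $$ (i, c) - (\<Sum>j<i. a i j * B $$ (j, c)))"
  shows "sds_map n A [0..<n] = B"
proof -
  have "k \<le> n \<Longrightarrow> sds_map n A [0..<k] =
      mat n n (\<lambda>(r, c). if r < k then B $$ (r, c) else if r = c then 1 else 0)" for k
  proof (induction k)
    case 0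
    show ?case by (auto simp: sds_map_def)
  next
    case (Suc k)
    let ?M = "mat n n (\<lambda>(r, c). if r < k then B $$ (r, c) else if r = c then 1 else 0)"
    have "local_mat n A k * ?M =
      mat n n (\<lambda>(r, c). if r < Suc k then B $$ (r, c) else if r = c then 1 else 0)" (is "_ = ?N")
    proof (rule eq_matI)
      fix r c assume "r < dim_row ?N" "c < dim_col ?N"
      then have rc: "r < n" "c < n" by auto
      have prod: "(local_mat n A k * ?M) $$ (r, c) =
        (\<Sum>j<n. (if r = k then A $$ (k, j) else if r = j then 1 else 0) *
                (if j < k then B $$ (j, c) else if j = c then 1 else 0))"
        using rc by (auto simp: local_mat_def scalar_prod_def lessThan_atLeast0 intro!: sum.cong)
      show "(local_mat n A k * ?M) $$ (r, c) = ?N $$ (r, c)"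
      proof (cases "r = k")
        case True
        \<comment> \<open>Indices below \<open>k\<close> meet updated rows of \<open>?M\<close>, the
          others meet identity rows.\<close>
        have split: "{..<n} = {..<k} \<union> {k..<n}" using Suc.prems by auto
        have "(local_mat n A k * ?M) $$ (r, c) =
          (\<Sum>j<k. A $$ (k, j) * B $$ (j, c)) + (\<Sum>j=k..<n. A $$ (k, j) * (if j = c then 1 else 0))"
          unfolding prod split using True by (subst sum.union_disjoint) auto
        also have "(\<Sum>j<k. A $$ (k, j) * B $$ (j, c)) = (\<Sum>j<k. a k j * B $$ (j, c))"
          using Suc.prems by (intro sum.cong) (auto simp: A)
        also have "(\<Sum>j=k..<n. A $$ (k, j) * (if j = c then 1 else 0)) = (if k \<le> c then A $$ (k, c) else 0)"
          using rc by (simp add: if_distrib[of "(*) _"] cong: if_cong)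
        \<comment> \<open>For \<open>c < k\<close> this is \<open>comb\<close>; for
          \<open>c \<ge> k\<close> the sum subtracted in \<open>A\<close> cancels.\<close>
        also have "(\<Sum>j<k. a k j * B $$ (j, c)) + \<dots> = B $$ (k, c)"
          using rc Suc.prems comb[of k c] by (auto simp: A)
        finally show ?thesis using True rc by simp
      next
        case False
        then have "(local_mat n A k * ?M) $$ (r, c) =
          (\<Sum>j<n. if r = j then (if j < k then B $$ (j, c) else if j = c then 1 else 0) else 0)"
          unfolding prod by (intro sum.cong) auto
        then show ?thesis using rc False by simp
      qed
    qed (auto simp: local_mat_def)
    then show ?case using Suc by (simp add: sds_map_def)
  qed
  from this[of n] show ?thesis using B by (auto intro!: eq_matI)
qed

text \<open>On the complete graph no two distinct vertices are non-adjacent, so compatibility forces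
  no entry to vanish. Connectedness demands a nonempty vertex set, whence
  \<open>n \<ge> 1\<close>.\<close>

lemma linear_sds_complete:
  fixes A :: "'a::field mat"
  assumes "n \<ge> 1" and "A \<in> carrier_mat n n"
  shows "\<exists>G. linear_sds n G A [0..<n]"
proof -
  define G where "G = \<lparr>pverts = {0..<n}, parcs = {(i, j). i < n \<and> j < n \<and> i \<noteq> j}\<rparr>"
  have G: "pverts G = {0..<n}" "parcs G = {(i, j). i < n \<and> j < n \<and> i \<noteq> j}" by (auto simp: G_def)
  have "finite (parcs G)" by (rule finite_subset[of _ "{0..<n} \<times> {0..<n}"]) (auto simp: G)
  moreover have "symmetric (with_proj G)"
    by (auto simp: symmetric_def sym_def G)
  ultimately interpret pair_graph G
    by unfold_locales (auto simp: G)
  have "u \<rightarrow>\<^sup>*\<^bsub>mk_symmetric (with_proj G)\<^esub> v" if "u < n" "v < n" for u v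
  proof (rule reachable_mk_symmetricI)
    show "u \<rightarrow>\<^sup>*\<^bsub>with_proj G\<^esub> v"
      using that by (cases "u = v") (auto simp: G)
  qed
  then have "Digraph_Component.connected (with_proj G)"
    using assms(1) by (intro connectedI) (auto simp: G)
  then have "linear_sds n G A [0..<n]"
    using assms pair_graph_axioms
    by (auto simp: linear_sds_def compatible_mat_def G permutations_of_set_def)
  then show ?thesis ..
qed

theorem theorem2:
  fixes n :: nat and T :: "'a::field mat"
  assumes "n \<ge> 1" and "T \<in> carrier_mat n n"
  shows "\<exists>P G A' \<pi>. permutation_mat n P \<and> linear_sds n G A' \<pi> \<and> sds_map n A' \<pi> = P * T"
proof -
  obtain xs where xs: "distinct xs" "set xs = {0..<n}"
    and "\<forall>i<length xs. \<exists>a. \<forall>c<i. T $$ (xs ! i, c) = (\<Sum>j<i. a j * T $$ (xs ! j, c))"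
    \<comment> \<open>Elimination starts with no column cleared, so the vanishing hypothesis is
      vacuous.\<close>
    using pivot_ordering[of "{0..<n}" 0 "\<lambda>r c. T $$ (r, c)"] by auto
  then obtain a where
    a: "\<And>i c. i < length xs \<Longrightarrow> c < i \<Longrightarrow> T $$ (xs ! i, c) = (\<Sum>j<i. a i j * T $$ (xs ! j, c))"
    by metis
  have len: "length xs = n" using distinct_card[OF xs(1)] xs(2) by simp
  \<comment> \<open>The identity outside the range is what \<open>permutes\<close> asks for.\<close>
  define \<sigma> where "\<sigma> i = (if i < n then xs ! i else i)" for i
  have "bij_betw ((!) xs) {0..<n} {0..<n}"
    using xs len by (intro bij_betw_nth) (auto simp: lessThan_atLeast0)
  moreover have "bij_betw \<sigma> {0..<n} {0..<n} \<longleftrightarrow> bij_betw ((!) xs) {0..<n} {0..<n}"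
    by (rule bij_betw_cong) (simp add: \<sigma>_def)
  ultimately have "bij_betw \<sigma> {0..<n} {0..<n}" by simp
  then have \<sigma>: "\<sigma> permutes {0..<n}" by (rule bij_imp_permutes) (auto simp: \<sigma>_def)
  define P :: "'a mat" where "P = mat n n (\<lambda>(i, j). if j = \<sigma> i then 1 else 0)"
  have PT: "(P * T) $$ (i, c) = T $$ (xs ! i, c)" if "i < n" "c < n" for i c
  proof -
    have "xs ! i < n" using that len xs(2) nth_mem[of i xs] by auto
    then show ?thesis
      using that assms(2)
      by (simp add: P_def \<sigma>_def scalar_prod_def if_distrib[of "\<lambda>x. x * _"] cong: if_cong)
  qed
  have PT_carrier: "P * T \<in> carrier_mat n n" using assms(2) by (auto simp: P_def)
  \<comment> \<open>The elimination coefficients become the entries of \<open>A\<close> left of the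
    diagonal.\<close>
  define A where "A = mat n n (\<lambda>(i, c). if c < i then a i c
    else (P * T) $$ (i, c) - (\<Sum>j<i. a i j * (P * T) $$ (j, c)))"
  have "sds_map n A [0..<n] = P * T"
    using PT_carrier
  proof (rule sds_map_upt[OF _ _ A_def])
    fix i c assume "i < n" "c < i"
    then show "(P * T) $$ (i, c) = (\<Sum>j<i. a i j * (P * T) $$ (j, c))"
      using a[of i c] len by (simp add: PT)
  qed
  moreover have "permutation_mat n P" using \<sigma> by (auto simp: permutation_mat_def P_def)
  moreover obtain G where "linear_sds n G A [0..<n]"
    using linear_sds_complete[of n A] assms(1) by (auto simp: A_def)
  ultimately show ?thesis by blast
qed

end
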